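(* Let $t\ge 1$ and $m\ge 4$ be integers, and let $(G,\mathcal{B})$ be a biased graph where $G$ is a loopless graph on $m$ vertices in which each pair of distinct vertices is joined by exactly $t$ parallel edges. Suppose each cycle in $\mathcal{B}$ has at least three edges, and $( * )$ for all distinct $b_1,b_2,b_3\in V(G)$, each edge $a$ with ends $b_1,b_2$ and each edge $b$ with ends $b_1,b_3$, there is an edge $c$ with ends $b_2,b_3$ such that $\{a,b,c\}\in\mathcal{B}$. Then there is a group $\Gamma$ with $|\Gamma|=t$ and a $\Gamma$-labeling of $G$ in which, for each pair of vertices, all edges joining them have the same orientation and pairwise distinct labels, and such that $\mathcal B$ is exactly the set of balanced cycles of this $\Gamma$-labeling.
   Context: A theta graph consists of two distinct vertices and three internally disjoint paths between them. A set $\mathcal B$ of cycles of $G$ satisfies the theta property if no theta subgraph of $G$ contains exactly two cycles in $\mathcal B$; a biased graph is a pair $(G,\mathcal B)$ with $\mathcal B$ a set of cycles satisfying the theta property. A $\Gamma$-labeling of $G$ is an orientation of its edges with a map $\phi:E(G)\to\Gamma$; for a walk $W$ with edges $e_1,\dots,e_k$, $\phi(W)=\prod_i\phi(e_i)^{\epsilon_i}$ with $\epsilon_i=\pm1$ according as $e_i$ is traversed forward or backward; a cycle is balanced if some simple closed walk $W$ around it has $\phi(W)=1$. *)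

theory Defs
  imports "HOL-Algebra.Coset"
begin

text \<open>Undirected multigraphs: \<open>ends G e\<close> is the set of ends of \<open>e\<close>, a singleton if \<open>e\<close> is a loop.\<close>

record ('v, 'e) multigraph =
  verts :: "'v set"
  edges :: "'e set"
  ends :: "'e \<Rightarrow> 'v set"

definition multigraph :: "('v, 'e) multigraph \<Rightarrow> bool" where
  "multigraph G \<longleftrightarrow>
     (\<forall>e\<in>edges G. ends G e \<subseteq> verts G \<and> card (ends G e) \<in> {1, 2})"

definition loopless :: "('v, 'e) multigraph \<Rightarrow> bool" where
  "loopless G \<longleftrightarrow> (\<forall>e\<in>edges G. card (ends G e) = 2)"

definition edges_between :: "('v, 'e) multigraph \<Rightarrow> 'v \<Rightarrow> 'v \<Rightarrow> 'e set" where
  "edges_between G x y = {e \<in> edges G. ends G e = {x, y}}"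

text \<open>The walk \<open>v\<^sub>0, e\<^sub>1, v\<^sub>1, \<dots>, e\<^sub>k, v\<^sub>k\<close> is given by its initial vertex \<open>v\<^sub>0\<close> and the list of
  pairs \<open>[(e\<^sub>1, v\<^sub>1), \<dots>, (e\<^sub>k, v\<^sub>k)]\<close>.\<close>

fun is_walk :: "('v, 'e) multigraph \<Rightarrow> 'v \<Rightarrow> ('e \<times> 'v) list \<Rightarrow> 'v \<Rightarrow> bool" where
  "is_walk G u [] w \<longleftrightarrow> u \<in> verts G \<and> u = w"
| "is_walk G u ((e, x) # p) w \<longleftrightarrow>
     u \<in> verts G \<and> e \<in> edges G \<and> ends G e = {u, x} \<and> is_walk G x p w"

definition walk_edges :: "('e \<times> 'v) list \<Rightarrow> 'e set" where
  "walk_edges p = set (map fst p)"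

definition is_path :: "('v, 'e) multigraph \<Rightarrow> 'v \<Rightarrow> ('e \<times> 'v) list \<Rightarrow> 'v \<Rightarrow> bool" where
  "is_path G u p w \<longleftrightarrow> is_walk G u p w \<and> distinct (u # map snd p)"

definition internal_verts :: "('e \<times> 'v) list \<Rightarrow> 'v set" where
  "internal_verts p = set (butlast (map snd p))"

text \<open>As \<open>v\<^sub>k = v\<^sub>0\<close>, distinctness of \<open>v\<^sub>1, \<dots>, v\<^sub>k\<close> says that no vertex is repeated.
  Distinctness of the edges only matters for \<open>k = 2\<close>, where it excludes going back along the
  same edge.\<close>

definition simple_closed_walk :: "('v, 'e) multigraph \<Rightarrow> 'v \<Rightarrow> ('e \<times> 'v) list \<Rightarrow> bool" where
  "simple_closed_walk G v p \<longleftrightarrow>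
     p \<noteq> [] \<and> is_walk G v p v \<and> distinct (map snd p) \<and> distinct (map fst p)"

text \<open>Cycles and theta subgraphs have no isolated vertices, so they are identified with their
  edge sets.\<close>

definition cycles :: "('v, 'e) multigraph \<Rightarrow> 'e set set" where
  "cycles G = {C. \<exists>v p. simple_closed_walk G v p \<and> C = walk_edges p}"

definition internally_disjoint :: "('e \<times> 'v) list \<Rightarrow> ('e \<times> 'v) list \<Rightarrow> bool" where
  "internally_disjoint p q \<longleftrightarrow> internal_verts p \<inter> internal_verts q = {}"

text \<open>Disjointness of the edge sets only matters for paths of length one, which have no internal
  vertices: it excludes using the same edge twice.\<close>

definition theta_subgraph :: "('v, 'e) multigraph \<Rightarrow> 'e set \<Rightarrow> bool" where
  "theta_subgraph G T \<longleftrightarrow>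
     (\<exists>u w p q r. u \<noteq> w \<and> is_path G u p w \<and> is_path G u q w \<and> is_path G u r w \<and>
        internally_disjoint p q \<and> internally_disjoint p r \<and> internally_disjoint q r \<and>
        walk_edges p \<inter> walk_edges q = {} \<and> walk_edges p \<inter> walk_edges r = {} \<and>
        walk_edges q \<inter> walk_edges r = {} \<and>
        T = walk_edges p \<union> walk_edges q \<union> walk_edges r)"

definition theta_property :: "('v, 'e) multigraph \<Rightarrow> 'e set set \<Rightarrow> bool" where
  "theta_property G B \<longleftrightarrow> (\<forall>T. theta_subgraph G T \<longrightarrow> card {C \<in> B. C \<subseteq> T} \<noteq> 2)"

definition biased_graph :: "('v, 'e) multigraph \<Rightarrow> 'e set set \<Rightarrow> bool" where
  "biased_graph G B \<longleftrightarrow> multigraph G \<and> B \<subseteq> cycles G \<and> theta_property G B"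

text \<open>A group labeling consists of an orientation, \<open>e\<close> being directed from \<open>src L e\<close> to
  \<open>tgt L e\<close>, and of a group element for each edge.\<close>

record ('v, 'e, 'g) labeling =
  src :: "'e \<Rightarrow> 'v"
  tgt :: "'e \<Rightarrow> 'v"
  label :: "'e \<Rightarrow> 'g"

definition group_labeling ::
  "('v, 'e) multigraph \<Rightarrow> 'g monoid \<Rightarrow> ('v, 'e, 'g) labeling \<Rightarrow> bool" where
  "group_labeling G \<Gamma> L \<longleftrightarrow>
     (\<forall>e\<in>edges G. ends G e = {src L e, tgt L e} \<and> label L e \<in> carrier \<Gamma>)"

text \<open>A non-loop step from \<open>u\<close> along \<open>e\<close> is forward iff \<open>u\<close> is the source of \<open>e\<close>. Loops always
  count as traversed forward; this has no effect on which cycles are balanced, since a loop lies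
  in no cycle of length greater than one.\<close>

fun walk_label ::
  "'g monoid \<Rightarrow> ('v, 'e, 'g) labeling \<Rightarrow> 'v \<Rightarrow> ('e \<times> 'v) list \<Rightarrow> 'g" where
  "walk_label \<Gamma> L u [] = \<one>\<^bsub>\<Gamma>\<^esub>"
| "walk_label \<Gamma> L u ((e, x) # p) =
     (if src L e = u then label L e else inv\<^bsub>\<Gamma>\<^esub> (label L e)) \<otimes>\<^bsub>\<Gamma>\<^esub> walk_label \<Gamma> L x p"

definition balanced_cycles ::
  "('v, 'e) multigraph \<Rightarrow> 'g monoid \<Rightarrow> ('v, 'e, 'g) labeling \<Rightarrow> 'e set set" where
  "balanced_cycles G \<Gamma> L =
     {C \<in> cycles G. \<exists>v p. simple_closed_walk G v p \<and> walk_edges p = C \<and>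
        walk_label \<Gamma> L v p = \<one>\<^bsub>\<Gamma>\<^esub>}"

end

theory Submission
  imports Defs "HOL-Algebra.Weak_Morphisms"
begin

text \<open>By the theta property, two adjacent edges \<open>a\<close>, \<open>b\<close> with distinct outer ends lie in a unique
  balanced triangle; let \<open>a \<star> b\<close> be its third edge. Two thetas in a complete graph on four vertices
  show that \<open>\<star>\<close> is associative along paths with three edges, so the edges compose like the morphisms
  of a groupoid. Fixing a root \<open>w\<close> and a system of edges that is closed under \<open>\<star>\<close>, one for each
  pair of vertices, each edge between vertices other than \<open>w\<close> acts as a permutation of one fixed set of
  edges at \<open>w\<close>, and these permutations form a group of order \<open>t\<close>. The resulting labels extend to the
  edges at \<open>w\<close>; a fourth vertex makes the extension independent of choices. A cycle is then compared with
  its label by induction on its length, using the theta formed by the cycle and a chord that cuts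
  off a balanced triangle.\<close>

subsection \<open>Cycles in theta subgraphs\<close>

lemma edges_between_commute: "edges_between G x y = edges_between G y x"
  by (auto simp: edges_between_def)

lemma walk_edges_simps [simp]:
  "walk_edges [] = {}" "walk_edges ((e, x) # p) = insert e (walk_edges p)"
  by (auto simp: walk_edges_def)

lemma ends_subset_walk_verts:
  "is_walk G u p w \<Longrightarrow> e \<in> walk_edges p \<Longrightarrow> ends G e \<subseteq> insert u (set (map snd p))"
  by (induction G u p w rule: is_walk.induct) auto

lemma walk_last: "is_walk G u p w \<Longrightarrow> p \<noteq> [] \<Longrightarrow> last (map snd p) = w"
  by (induction G u p w rule: is_walk.induct) (auto simp: last_map)

lemma walk_end_mem: "is_walk G u p w \<Longrightarrow> p \<noteq> [] \<Longrightarrow> w \<in> set (map snd p)"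
  using walk_last[of G u p w] last_in_set[of "map snd p"] by auto

lemma set_verts_walk:
  "is_walk G u p w \<Longrightarrow> p \<noteq> [] \<Longrightarrow> set (map snd p) = insert w (internal_verts p)"
  using walk_last[of G u p w] append_butlast_last_id[of "map snd p"]
  by (metis internal_verts_def list.map_disc_iff rotate1.simps(2) list.simps(15) set_rotate1)

lemma path_distinct_edges: "is_path G u p w \<Longrightarrow> distinct (map fst p)"
proof (induction p arbitrary: u)
  case (Cons a p)
  obtain e x where a: "a = (e, x)" by force
  have w: "is_walk G x p w" "ends G e = {u, x}" and d: "u \<notin> insert x (set (map snd p))"
    "is_path G x p w"
    using Cons.prems by (auto simp: a is_path_def)
  have "e \<notin> walk_edges p"
    using ends_subset_walk_verts[OF w(1)] w(2) d(1) by blast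
  then show ?case
    using Cons.IH[OF d(2)] by (auto simp: a walk_edges_def)
qed simp

section \<open>Parity of degrees in walks and cycles\<close>

definition incident :: "('v, 'e) multigraph \<Rightarrow> 'e set \<Rightarrow> 'v \<Rightarrow> 'e set" where
  "incident G D x = {e \<in> D. x \<in> ends G e}"

text \<open>Prepending an edge flips the parity exactly at its two ends, which are distinct because
  \<open>G\<close> is loopless. So a closed trail has only even degrees, and an open one is odd
  exactly at its two ends.\<close>

lemma even_card_incident_walk:
  "loopless G \<Longrightarrow> is_walk G u p w \<Longrightarrow> distinct (map fst p) \<Longrightarrow>
    even (card (incident G (walk_edges p) x)) \<longleftrightarrow> ((x = u) = (x = w))"
proof (induction p arbitrary: u)
  case Nil
  then show ?case by (simp add: incident_def)
next
  case (Cons a p)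
  obtain e y where a: "a = (e, y)" by force
  have fin: "finite (incident G (walk_edges p) x)"
    by (simp add: incident_def walk_edges_def)
  have e: "ends G e = {u, y}" "e \<in> edges G" "is_walk G y p w"
    using Cons.prems by (auto simp: a)
  have notin: "e \<notin> incident G (walk_edges p) x"
    using Cons.prems by (auto simp: a walk_edges_def incident_def)
  have uy: "u \<noteq> y"
    using e Cons.prems(1) by (auto simp: loopless_def)
  have IH: "even (card (incident G (walk_edges p) x)) \<longleftrightarrow> ((x = y) = (x = w))"
    using Cons by (auto simp: a)
  have "incident G (walk_edges (a # p)) x =
      (if x = u \<or> x = y then insert e (incident G (walk_edges p) x) else incident G (walk_edges p) x)"
    using e(1) by (auto simp: a incident_def)
  then show ?case
    using IH uy fin notin by auto
qed

text \<open>At an internal vertex only the two path edges meeting there can belong to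
  \<open>D\<close>, and evenness admits both or neither. Membership in \<open>D\<close> thus
  propagates along the whole path.\<close>

lemma path_all_or_nothing:
  "is_path G u p w \<Longrightarrow>
    (\<And>x. x \<in> internal_verts p \<Longrightarrow> even (card (incident G D x)) \<and> incident G D x \<subseteq> walk_edges p) \<Longrightarrow>
    walk_edges p \<subseteq> D \<or> walk_edges p \<inter> D = {}"
proof (induction p arbitrary: u)
  case (Cons a p)
  obtain e x where a: "a = (e, x)" by force
  show ?case
  proof (cases p)
    case Nil
    then show ?thesis by (auto simp: a)
  next
    case (Cons b p')
    obtain f y where b: "b = (f, y)" by force
    have path: "is_path G x p w" and ex: "ends G e = {u, x}" and ux: "u \<noteq> x"
      and u: "u \<notin> set (map snd p)" and x: "x \<notin> set (map snd p)"
      using Cons.prems(1) by (auto simp: a is_path_def)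
    have w': "is_walk G y p' w" and f: "ends G f = {x, y}" and xy: "x \<noteq> y" "u \<noteq> y"
      and xp: "x \<notin> set (map snd p')"
      using path u by (auto simp: Cons b is_path_def)
    have int: "internal_verts (a # p) = insert x (internal_verts p)"
      by (simp add: internal_verts_def a Cons)
    have sub: "internal_verts p \<subseteq> set (map snd p)"
      unfolding internal_verts_def by (meson in_set_butlastD subsetI)
    have tail: "walk_edges p \<subseteq> D \<or> walk_edges p \<inter> D = {}"
    proof (rule Cons.IH[OF path])
      fix z assume z: "z \<in> internal_verts p"
      then have "z \<notin> ends G e" using u x sub by (auto simp: ex)
      moreover have "even (card (incident G D z)) \<and> incident G D z \<subseteq> walk_edges (a # p)"
        using Cons.prems(2) z by (simp add: int)
      ultimately show "even (card (incident G D z)) \<and> incident G D z \<subseteq> walk_edges p"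
        by (auto simp: a incident_def)
    qed
    have "e \<in> D \<longleftrightarrow> f \<in> D"
    proof -
      have ev: "even (card (incident G D x))" and "incident G D x \<subseteq> walk_edges (a # p)"
        using Cons.prems(2) by (simp_all add: int)
      moreover have "x \<notin> ends G g" if "g \<in> walk_edges p'" for g
        using ends_subset_walk_verts[OF w' that] xp xy by auto
      ultimately have "incident G D x = D \<inter> {e, f}"
        using ex f by (auto simp: incident_def a b Cons)
      moreover have "e \<noteq> f" using ex f xy ux by (metis doubleton_eq_iff)
      ultimately show ?thesis
        using ev by (cases "e \<in> D"; cases "f \<in> D") auto
    qed
    then show ?thesis using tail by (auto simp: a b Cons)
  qed
qed simp

lemma even_card_incident_cycle:
  assumes "loopless G" "D \<in> cycles G"
  shows "even (card (incident G D x))"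
  using assms even_card_incident_walk[OF assms(1)]
  by (auto simp: cycles_def simple_closed_walk_def)

lemma internal_notin_ends:
  assumes "is_path G u p w" "x \<in> internal_verts p"
  shows "x \<noteq> u \<and> x \<noteq> w"
proof -
  have ne: "p \<noteq> []" using assms(2) by (auto simp: internal_verts_def)
  have "map snd p = butlast (map snd p) @ [w]"
    using walk_last[of G u p w] ne assms(1)
    by (metis append_butlast_last_id is_path_def list.map_disc_iff)
  then have "distinct (u # butlast (map snd p) @ [w])"
    using assms(1) by (metis is_path_def)
  then show ?thesis using assms(2) by (auto simp: internal_verts_def)
qed

lemma incident_internal_subset:
  assumes "is_path G u p w" "is_path G u q w" "internally_disjoint p q" "u \<noteq> w"
    and "x \<in> internal_verts p" "e \<in> walk_edges q"
  shows "x \<notin> ends G e"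
proof
  assume "x \<in> ends G e"
  have "q \<noteq> []" using assms(6) by auto
  then have "x \<in> insert u (insert w (internal_verts q))"
    using ends_subset_walk_verts[of G u q w e] set_verts_walk[of G u q w] assms(2,6) \<open>x \<in> ends G e\<close>
    by (auto simp: is_path_def)
  then show False
    using internal_notin_ends[OF assms(1,5)] assms(3,5) by (auto simp: internally_disjoint_def)
qed

text \<open>All degrees in \<open>D\<close> are even, so \<open>D\<close> is a union of some of the
  three paths. Each path has odd degree at \<open>u\<close>, hence an even, nonzero number of them
  occurs, which is two.\<close>

lemma cycle_in_theta:
  assumes "loopless G" "u \<noteq> w"
    and P: "is_path G u p w" and Q: "is_path G u q w" and R: "is_path G u r w"
    and pq: "internally_disjoint p q" and pr: "internally_disjoint p r"
    and qr: "internally_disjoint q r"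
    and disj: "walk_edges p \<inter> walk_edges q = {}" "walk_edges p \<inter> walk_edges r = {}"
      "walk_edges q \<inter> walk_edges r = {}"
    and D: "D \<in> cycles G" "D \<subseteq> walk_edges p \<union> walk_edges q \<union> walk_edges r"
  shows "D \<in> {walk_edges p \<union> walk_edges q, walk_edges p \<union> walk_edges r,
    walk_edges q \<union> walk_edges r}"
proof -
  have sym: "internally_disjoint q p" "internally_disjoint r p" "internally_disjoint r q"
    using pq pr qr by (auto simp: internally_disjoint_def)
  have ev: "even (card (incident G D x))" for x
    using even_card_incident_cycle[OF assms(1) D(1)] .
  have p: "walk_edges p \<subseteq> D \<or> walk_edges p \<inter> D = {}"
    by (rule path_all_or_nothing[OF P])
      (use ev D(2) incident_internal_subset[OF P Q pq \<open>u \<noteq> w\<close>]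
        incident_internal_subset[OF P R pr \<open>u \<noteq> w\<close>] in \<open>auto simp: incident_def\<close>)
  have q: "walk_edges q \<subseteq> D \<or> walk_edges q \<inter> D = {}"
    by (rule path_all_or_nothing[OF Q])
      (use ev D(2) incident_internal_subset[OF Q P sym(1) \<open>u \<noteq> w\<close>]
        incident_internal_subset[OF Q R qr \<open>u \<noteq> w\<close>] in \<open>auto simp: incident_def\<close>)
  have r: "walk_edges r \<subseteq> D \<or> walk_edges r \<inter> D = {}"
    by (rule path_all_or_nothing[OF R])
      (use ev D(2) incident_internal_subset[OF R P sym(2) \<open>u \<noteq> w\<close>]
        incident_internal_subset[OF R Q sym(3) \<open>u \<noteq> w\<close>] in \<open>auto simp: incident_def\<close>)
  have odd: "odd (card (incident G (walk_edges s) u))" if "is_path G u s w" for s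
    using even_card_incident_walk[OF assms(1), of u s w u] that path_distinct_edges[OF that]
      \<open>u \<noteq> w\<close> by (auto simp: is_path_def)
  have fin: "finite (incident G (walk_edges s) u)" for s
    by (simp add: incident_def walk_edges_def)
  have un: "incident G (A \<union> C) u = incident G A u \<union> incident G C u" for A C
    by (auto simp: incident_def)
  have "D \<noteq> {}" using D(1) by (auto simp: cycles_def simple_closed_walk_def walk_edges_def)
  have not1: "D \<noteq> walk_edges s" if "is_path G u s w" for s
    using odd[OF that] ev by auto
  have not3: "D \<noteq> walk_edges p \<union> walk_edges q \<union> walk_edges r"
  proof -
    have "card (incident G (walk_edges p \<union> walk_edges q \<union> walk_edges r) u) =
        card (incident G (walk_edges p) u) + card (incident G (walk_edges q) u)
        + card (incident G (walk_edges r) u)"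
    proof -
      have "incident G (walk_edges p) u \<inter> incident G (walk_edges q) u = {}"
        "(incident G (walk_edges p) u \<union> incident G (walk_edges q) u) \<inter> incident G (walk_edges r) u = {}"
        using disj by (auto simp: incident_def)
      then show ?thesis by (simp add: un card_Un_disjoint fin)
    qed
    then show ?thesis using odd[OF P] odd[OF Q] odd[OF R] ev[of u] by auto
  qed
  have "D = (if walk_edges p \<subseteq> D then walk_edges p else {}) \<union>
      (if walk_edges q \<subseteq> D then walk_edges q else {}) \<union>
      (if walk_edges r \<subseteq> D then walk_edges r else {})"
    using p q r D(2) by auto
  then show ?thesis
    using \<open>D \<noteq> {}\<close> not1[OF P] not1[OF Q] not1[OF R] not3
    by (cases "walk_edges p \<subseteq> D"; cases "walk_edges q \<subseteq> D"; cases "walk_edges r \<subseteq> D") auto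
qed

text \<open>The form in which the theta property is applied below: by \<open>cycle_in_theta\<close>
  a theta has only its three obvious cycles, so two of them in \<open>B\<close> without the third
  would be exactly two.\<close>

lemma theta_transfer:
  assumes "biased_graph G B" "loopless G" "u \<noteq> w"
    and "is_path G u p w" "is_path G u q w" "is_path G u r w"
    and "internally_disjoint p q" "internally_disjoint p r" "internally_disjoint q r"
    and "walk_edges p \<inter> walk_edges q = {}" "walk_edges p \<inter> walk_edges r = {}"
      "walk_edges q \<inter> walk_edges r = {}"
    and bal: "walk_edges p \<union> walk_edges q \<in> B" "walk_edges p \<union> walk_edges r \<in> B"
  shows "walk_edges q \<union> walk_edges r \<in> B"
proof (rule ccontr)
  assume n: "walk_edges q \<union> walk_edges r \<notin> B"
  let ?T = "walk_edges p \<union> walk_edges q \<union> walk_edges r"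
  have "theta_subgraph G ?T"
    unfolding theta_subgraph_def using assms by blast
  then have "card {C \<in> B. C \<subseteq> ?T} \<noteq> 2"
    using assms(1) by (auto simp: biased_graph_def theta_property_def)
  moreover have "{C \<in> B. C \<subseteq> ?T} = {walk_edges p \<union> walk_edges q, walk_edges p \<union> walk_edges r}"
  proof
    show "{C \<in> B. C \<subseteq> ?T} \<subseteq> {walk_edges p \<union> walk_edges q, walk_edges p \<union> walk_edges r}"
    proof
      fix C assume C: "C \<in> {C \<in> B. C \<subseteq> ?T}"
      then have "C \<in> cycles G" using assms(1) by (auto simp: biased_graph_def)
      from cycle_in_theta[OF assms(2-12) this] C n
      show "C \<in> {walk_edges p \<union> walk_edges q, walk_edges p \<union> walk_edges r}" by auto
    qed
  qed (use bal in auto)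
  \<comment> \<open>Distinctness of the two cycles is what makes the cardinality 2 rather than
    1.\<close>
  moreover have "walk_edges p \<union> walk_edges q \<noteq> walk_edges p \<union> walk_edges r"
  proof -
    have "q \<noteq> []" using assms(3,5) by (auto simp: is_path_def)
    then have "walk_edges q \<noteq> {}" by (auto simp: walk_edges_def)
    then show ?thesis using assms(10-12) by auto
  qed
  ultimately show False by simp
qed

subsection \<open>The partial product on edges\<close>

locale triangular_biased_graph =
  fixes G :: "('v, 'e) multigraph" and B :: "'e set set" and t :: nat
  assumes biased: "biased_graph G B"
    and loopless: "loopless G"
    and card_verts: "card (verts G) \<ge> 4"
    and t_pos: "t \<ge> 1"
    and card_edges_between:
      "\<And>x y. x \<in> verts G \<Longrightarrow> y \<in> verts G \<Longrightarrow> x \<noteq> y \<Longrightarrow> card (edges_between G x y) = t"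
    and card_balanced: "\<And>C. C \<in> B \<Longrightarrow> card C \<ge> 3"
    and triangle: "\<And>x y z a b. x \<in> verts G \<Longrightarrow> y \<in> verts G \<Longrightarrow> z \<in> verts G \<Longrightarrow>
      x \<noteq> y \<Longrightarrow> x \<noteq> z \<Longrightarrow> y \<noteq> z \<Longrightarrow> a \<in> edges_between G x y \<Longrightarrow> b \<in> edges_between G x z \<Longrightarrow>
      \<exists>c\<in>edges_between G y z. {a, b, c} \<in> B"
begin

abbreviation E :: "'v \<Rightarrow> 'v \<Rightarrow> 'e set" where "E \<equiv> edges_between G"
abbreviation V :: "'v set" where "V \<equiv> verts G"

lemma E_D: "e \<in> E x y \<Longrightarrow> x \<in> V \<and> y \<in> V \<and> x \<noteq> y \<and> e \<in> edges G \<and> ends G e = {x, y}"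
  using biased loopless
  by (force simp: biased_graph_def multigraph_def loopless_def edges_between_def)

lemma E_nonempty: "x \<in> V \<Longrightarrow> y \<in> V \<Longrightarrow> x \<noteq> y \<Longrightarrow> E x y \<noteq> {}"
  using card_edges_between t_pos by fastforce

text \<open>All uses of \<open>card_verts\<close> pass through here. The three vertices may
  coincide, so the same fact also supplies a vertex off one or two given ones.\<close>

lemma fourth_vertex: "\<exists>p\<in>V. p \<noteq> x \<and> p \<noteq> y \<and> p \<noteq> z"
proof (rule ccontr)
  assume "\<not> ?thesis"
  then have "V \<subseteq> {x, y, z}" by auto
  then have "card V \<le> card {x, y, z}" by (simp add: card_mono)
  also have "\<dots> \<le> 3" by (simp add: card_insert_if)
  finally show False using card_verts by simp
qed

text \<open>Otherwise the two parallel edges and the path through \<open>y\<close> form a theta with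
  two balanced triangles, which balances the digon on \<open>c\<close> and \<open>d\<close>; but
  members of \<open>B\<close> have at least three edges.\<close>

lemma third_edge_unique:
  assumes "a \<in> E x y" "b \<in> E y z" "x \<noteq> z" "c \<in> E x z" "d \<in> E x z" "{a, b, c} \<in> B" "{a, b, d} \<in> B"
  shows "c = d"
proof (rule ccontr)
  assume cd: "c \<noteq> d"
  note D = E_D[OF assms(1)] E_D[OF assms(2)] E_D[OF assms(4)] E_D[OF assms(5)]
  have "walk_edges [(c, z)] \<union> walk_edges [(d, z)] \<in> B"
  proof (rule theta_transfer[OF biased loopless, where u = x and w = z and p = "[(a, y), (b, z)]"])
    show "walk_edges [(a, y), (b, z)] \<inter> walk_edges [(c, z)] = {}"
      "walk_edges [(a, y), (b, z)] \<inter> walk_edges [(d, z)] = {}"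
      "walk_edges [(c, z)] \<inter> walk_edges [(d, z)] = {}"
      using D cd by (auto simp: doubleton_eq_iff)
  qed (use D assms in \<open>auto simp: is_path_def internally_disjoint_def internal_verts_def insert_commute\<close>)
  then have "card {c, d} \<ge> 3" using card_balanced by (metis walk_edges_simps insert_is_Un)
  then show False using cd by simp
qed

text \<open>The ends of the third edge form the symmetric difference of those of \<open>a\<close> and \<open>b\<close>, so the
  three vertices need not be arguments.\<close>

definition third_edge :: "'e \<Rightarrow> 'e \<Rightarrow> 'e" (infixl "\<star>" 70) where
  "a \<star> b = (THE c. c \<in> edges G \<and> ends G c = (ends G a - ends G b) \<union> (ends G b - ends G a)
     \<and> {a, b, c} \<in> B)"

lemma third_edge_eqI:
  assumes "a \<in> E x y" "b \<in> E y z" "x \<noteq> z" "c \<in> E x z" "{a, b, c} \<in> B"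
  shows "a \<star> b = c"
proof -
  have "(ends G a - ends G b) \<union> (ends G b - ends G a) = {x, z}"
    using E_D[OF assms(1)] E_D[OF assms(2)] assms(3) by auto
  then show ?thesis
    unfolding third_edge_def
    using assms third_edge_unique[OF assms(1-3)]
    by (intro the_equality) (auto simp: edges_between_def)
qed

lemma third_edge:
  assumes "a \<in> E x y" "b \<in> E y z" "x \<noteq> z"
  shows "a \<star> b \<in> E x z" "{a, b, a \<star> b} \<in> B"
proof -
  obtain c where "c \<in> E x z" "{a, b, c} \<in> B"
    using triangle[of y x z a b] E_D[OF assms(1)] E_D[OF assms(2)] assms
    by (auto simp: edges_between_commute)
  then show "a \<star> b \<in> E x z" "{a, b, a \<star> b} \<in> B"
    using third_edge_eqI[OF assms] by auto
qed

lemma third_edge_commute: "a \<star> b = b \<star> a"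
  unfolding third_edge_def by (simp add: insert_commute Un_commute)

text \<open>A balanced triangle has no preferred edge, so any two of its edges determine the third.
  Read backwards, an edge therefore acts as its own inverse.\<close>

lemma third_edge_left_cancel:
  assumes "a \<in> E x y" "b \<in> E y z" "x \<noteq> z"
  shows "a \<star> (a \<star> b) = b"
  by (rule third_edge_eqI[where x = y and y = x and z = z])
    (use assms third_edge[OF assms] E_D[OF assms(2)] in
      \<open>auto simp: edges_between_commute insert_commute\<close>)

lemma third_edge_right_cancel:
  assumes "a \<in> E x y" "b \<in> E y z" "x \<noteq> z"
  shows "(a \<star> b) \<star> b = a"
  using third_edge_left_cancel[of b z y a x] assms
  by (metis edges_between_commute third_edge_commute)

text \<open>In a complete graph on four vertices, two balanced triangles make their sum, a 4-cycle,
  balanced. A third balanced triangle cuts this 4-cycle into two, and so balances the fourth.\<close>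

lemma fourth_triangle_balanced:
  assumes "a \<in> E x y" "b \<in> E y z" "c \<in> E z w" "d \<in> E x z" "f \<in> E y w" "g \<in> E x w"
    and "{a, b, d} \<in> B" "{d, c, g} \<in> B" "{b, c, f} \<in> B"
  shows "{a, f, g} \<in> B"
proof -
  note D = E_D[OF assms(1)] E_D[OF assms(2)] E_D[OF assms(3)] E_D[OF assms(4)] E_D[OF assms(5)]
    E_D[OF assms(6)]
  have four: "walk_edges [(d, x), (g, w)] \<union> walk_edges [(b, y), (f, w)] \<in> B"
    by (rule theta_transfer[OF biased loopless, where u = z and w = w and p = "[(c, w)]"])
      (use D assms in \<open>auto simp: is_path_def internally_disjoint_def internal_verts_def
        insert_commute doubleton_eq_iff\<close>)
  have "walk_edges [(a, y)] \<union> walk_edges [(g, w), (f, y)] \<in> B"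
    by (rule theta_transfer[OF biased loopless, where u = x and w = y and p = "[(d, z), (b, y)]"])
      (use D assms four in \<open>auto simp: is_path_def internally_disjoint_def internal_verts_def
        insert_commute doubleton_eq_iff\<close>)
  then show ?thesis by (simp add: insert_commute)
qed

text \<open>The products \<open>a \<star> b\<close>, \<open>b \<star> c\<close> and
  \<open>(a \<star> b) \<star> c\<close> supply three balanced triangles on the vertices
  \<open>x\<close>, \<open>y\<close>, \<open>z\<close>, \<open>w\<close>. Then the triangle on
  \<open>a\<close>, \<open>b \<star> c\<close> and \<open>(a \<star> b) \<star> c\<close> is
  balanced too, and the third edge is unique.\<close>

lemma third_edge_assoc:
  assumes "a \<in> E x y" "b \<in> E y z" "c \<in> E z w" "x \<noteq> z" "y \<noteq> w" "x \<noteq> w"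
  shows "(a \<star> b) \<star> c = a \<star> (b \<star> c)"
proof -
  note ab = third_edge[OF assms(1,2,4)] and bc = third_edge[OF assms(2,3,5)]
  note abc = third_edge[OF ab(1) assms(3,6)]
  show ?thesis
    using third_edge_eqI[OF assms(1) bc(1) assms(6) abc(1)]
      fourth_triangle_balanced[OF assms(1-3) ab(1) bc(1) abc(1) ab(2) abc(2) bc(2)]
    by simp
qed

end

subsection \<open>The group of permutations\<close>

locale rooted_triangular_biased_graph = triangular_biased_graph G B t
  for G :: "('v, 'e) multigraph" and B t +
  fixes w u :: 'v
  assumes root: "w \<in> V" "u \<in> V" "u \<noteq> w"
begin

text \<open>Only the edges at \<open>w\<close> are chosen freely; closure under
  \<open>\<star>\<close> forces the others. These edges play the part of identities: those away from
  \<open>w\<close> induce the identity permutation (\<open>perm_base_edge\<close>).\<close>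

definition base_edge :: "'v \<Rightarrow> 'v \<Rightarrow> 'e" where
  "base_edge x y = (let g = \<lambda>x. SOME e. e \<in> E w x in
     if x = w then g y else if y = w then g x else g x \<star> g y)"

lemma base_edge_in:
  assumes "x \<in> V" "y \<in> V" "x \<noteq> y"
  shows "base_edge x y \<in> E x y"
proof -
  have g: "(SOME e. e \<in> E w z) \<in> E w z" if "z \<in> V" "z \<noteq> w" for z
    using E_nonempty[of w z] root that by (simp add: some_in_eq)
  show ?thesis
    using assms g[of x] g[of y] third_edge(1)[of "SOME e. e \<in> E w x" x w "SOME e. e \<in> E w y" y]
    by (auto simp: base_edge_def Let_def edges_between_commute)
qed

lemma base_edge_commute: "base_edge x y = base_edge y x"
  by (auto simp: base_edge_def Let_def third_edge_commute)

lemma base_edge_split: "x \<noteq> w \<Longrightarrow> y \<noteq> w \<Longrightarrow> base_edge x y = base_edge x w \<star> base_edge w y"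
  by (auto simp: base_edge_def Let_def)

text \<open>If the triangle contains \<open>w\<close>, this is the definition or a cancellation.
  Otherwise the edges are expanded through \<open>w\<close>, and after associativity along
  \<open>x\<close>, \<open>w\<close>, \<open>y\<close>, \<open>z\<close> the detour from
  \<open>w\<close> to \<open>y\<close> and back cancels.\<close>

lemma base_edge_mult:
  assumes "x \<in> V" "y \<in> V" "z \<in> V" "x \<noteq> y" "y \<noteq> z" "x \<noteq> z"
  shows "base_edge x y \<star> base_edge y z = base_edge x z"
proof -
  note F = base_edge_in[OF assms(1,2,4)] base_edge_in[OF assms(2,3,5)] base_edge_in[OF assms(1,3,6)]
  have Fw: "base_edge p w \<in> E p w" "base_edge w p \<in> E w p" if "p \<in> V" "p \<noteq> w" for p
    using base_edge_in[of p w] base_edge_in[of w p] root that by auto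
  consider "x = w" | "y = w" | "z = w" | "x \<noteq> w" "y \<noteq> w" "z \<noteq> w" by blast
  then show ?thesis
  proof cases
    case 1
    then have "base_edge x y \<star> base_edge y z = base_edge w y \<star> (base_edge y w \<star> base_edge w z)"
      using assms base_edge_split[of y z] by simp
    also have "\<dots> = base_edge w z"
      using third_edge_left_cancel[of "base_edge w y" y w "base_edge w z" z] Fw[of y] Fw[of z]
        assms 1 base_edge_commute[of y w] by (simp add: edges_between_commute)
    finally show ?thesis using 1 by simp
  next
    case 2
    then show ?thesis using base_edge_split assms by simp
  next
    case 3
    then have "base_edge x y \<star> base_edge y z = (base_edge x w \<star> base_edge w y) \<star> base_edge w y"
      using assms base_edge_split[of x y] base_edge_commute[of y w] by simp
    also have "\<dots> = base_edge x w"
      using third_edge_right_cancel[of "base_edge x w" x w "base_edge w y" y] Fw[of x] Fw[of y]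
        assms 3 by simp
    finally show ?thesis using 3 by simp
  next
    case 4
    have "base_edge x y \<star> base_edge y z = (base_edge x w \<star> base_edge w y) \<star> base_edge y z"
      using base_edge_split[of x y] 4 by simp
    also have "\<dots> = base_edge x w \<star> (base_edge w y \<star> base_edge y z)"
      using third_edge_assoc[of "base_edge x w" x w "base_edge w y" y "base_edge y z" z]
        Fw[of x] Fw[of y] F assms 4 by auto
    also have "base_edge w y \<star> base_edge y z = base_edge w y \<star> (base_edge w y \<star> base_edge w z)"
      using 4 base_edge_split[of y z] base_edge_commute[of y w] by simp
    also have "\<dots> = base_edge w z"
      using third_edge_left_cancel[of "base_edge w y" y w "base_edge w z" z] Fw[of y] Fw[of z]
        assms 4 by (simp add: edges_between_commute)
    finally show ?thesis using base_edge_split[of x z] 4 by simp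
  qed
qed

section \<open>Moving edges at the root into one fixed set\<close>

definition transport :: "'v \<Rightarrow> 'e \<Rightarrow> 'e" where
  "transport x a = (if x = u then a else base_edge u x \<star> a)"

text \<open>Multiplying twice by the same base edge cancels, so the one map
  \<open>transport x\<close> serves in both directions between \<open>E x w\<close> and
  \<open>E u w\<close>. The case \<open>x = u\<close> is separate since no edge joins
  \<open>u\<close> to itself.\<close>

lemma transport_to:
  assumes "a \<in> E x w"
  shows "transport x a \<in> E u w" "transport x (transport x a) = a"
  using assms third_edge(1)[of "base_edge u x" u x a w] E_D[OF assms] root base_edge_in[of u x]
    third_edge_left_cancel[of "base_edge u x" u x a w]
  by (auto simp: transport_def)

lemma transport_from:
  assumes "s \<in> E u w" "x \<in> V" "x \<noteq> w"
  shows "transport x s \<in> E x w" "transport x (transport x s) = s"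
  using assms third_edge(1)[of "base_edge u x" x u s w] root base_edge_in[of u x]
    third_edge_left_cancel[of "base_edge u x" x u s w]
  by (auto simp: transport_def edges_between_commute)

lemma base_edge_transport:
  assumes "s \<in> E u w" "x \<in> V" "y \<in> V" "x \<noteq> w" "y \<noteq> w" "x \<noteq> y"
  shows "base_edge x y \<star> transport y s = transport x s"
proof -
  note F = base_edge_in
  consider "x = u" | "y = u" | "x \<noteq> u" "y \<noteq> u" by blast
  then show ?thesis
  proof cases
    case 1
    then show ?thesis
      using third_edge_left_cancel[of "base_edge u y" y u s w] F[of u y] assms root
      by (simp add: transport_def edges_between_commute)
  next
    case 2
    then show ?thesis using assms base_edge_commute by (simp add: transport_def)
  next
    case 3
    have "base_edge x y \<star> (base_edge y u \<star> s) = (base_edge x y \<star> base_edge y u) \<star> s"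
      using third_edge_assoc[of "base_edge x y" x y "base_edge y u" u s w] F[of x y] F[of y u]
        assms root 3 by simp
    also have "base_edge x y \<star> base_edge y u = base_edge x u"
      using base_edge_mult assms root 3 by simp
    finally show ?thesis using 3 by (simp add: transport_def base_edge_commute)
  qed
qed

text \<open>An edge from \<open>x\<close> to \<open>y\<close> sends the edges from \<open>y\<close> to the root \<open>w\<close> to those from \<open>x\<close> to \<open>w\<close>;
  transporting both sets to \<open>E u w\<close> turns it into a permutation.\<close>

definition perm :: "'v \<Rightarrow> 'v \<Rightarrow> 'e \<Rightarrow> 'e \<Rightarrow> 'e" where
  "perm x y e = (\<lambda>s\<in>E u w. transport x (e \<star> transport y s))"

lemma perm_maps:
  assumes "e \<in> E x y" "x \<noteq> w" "y \<noteq> w"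
  shows "perm x y e \<in> E u w \<rightarrow> E u w"
  using assms E_D[OF assms(1)] transport_to(1)[of _ x] transport_from(1)[of _ y]
    third_edge(1)[OF assms(1), of _ w]
  by (auto simp: perm_def)

text \<open>The two inner transports at \<open>y\<close> cancel, leaving associativity along the
  path \<open>x\<close>, \<open>y\<close>, \<open>z\<close>, \<open>w\<close>. The condition
  \<open>x \<noteq> z\<close> excludes going back; a return along the same edge is treated in
  \<open>perm_inverse\<close>.\<close>

lemma perm_mult:
  assumes "e \<in> E x y" "f \<in> E y z" "x \<noteq> z" "x \<noteq> w" "y \<noteq> w" "z \<noteq> w"
  shows "compose (E u w) (perm x y e) (perm y z f) = perm x z (e \<star> f)"
proof
  fix s
  show "compose (E u w) (perm x y e) (perm y z f) s = perm x z (e \<star> f) s"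
  proof (cases "s \<in> E u w")
    case True
    have ks: "transport z s \<in> E z w" using transport_from(1) True E_D[OF assms(2)] assms by simp
    have fk: "f \<star> transport z s \<in> E y w" using third_edge(1)[OF assms(2) ks] assms by simp
    have "compose (E u w) (perm x y e) (perm y z f) s = transport x (e \<star> (f \<star> transport z s))"
      using True transport_to[OF fk] by (simp add: compose_def perm_def)
    also have "e \<star> (f \<star> transport z s) = (e \<star> f) \<star> transport z s"
      using third_edge_assoc[OF assms(1,2) ks] assms by simp
    finally show ?thesis using True by (simp add: perm_def[of x z])
  qed (simp add: compose_def perm_def)
qed

lemma perm_inverse:
  assumes "e \<in> E x y" "x \<noteq> w" "y \<noteq> w"
  shows "compose (E u w) (perm x y e) (perm y x e) = (\<lambda>s\<in>E u w. s)"
proof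
  fix s
  show "compose (E u w) (perm x y e) (perm y x e) s = (\<lambda>s\<in>E u w. s) s"
  proof (cases "s \<in> E u w")
    case True
    have ks: "transport x s \<in> E x w" using transport_from(1) True E_D[OF assms(1)] assms by simp
    have ek: "e \<star> transport x s \<in> E y w"
      using third_edge(1)[of e y x _ w] ks assms by (simp add: edges_between_commute)
    have "e \<star> (e \<star> transport x s) = transport x s"
      using third_edge_left_cancel[of e y x _ w] ks assms by (simp add: edges_between_commute)
    then show ?thesis
      using True transport_to[OF ek] transport_from(2)[of s x] E_D[OF assms(1)] assms
      by (simp add: compose_def perm_def)
  qed (simp add: compose_def perm_def)
qed

lemma perm_base_edge:
  assumes "x \<in> V" "y \<in> V" "x \<noteq> w" "y \<noteq> w" "x \<noteq> y"
  shows "perm x y (base_edge x y) = (\<lambda>s\<in>E u w. s)"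
  using assms base_edge_transport transport_from(2) by (auto simp: perm_def restrict_def)

text \<open>A single value determines the edge: at any \<open>s\<close>, undoing
  \<open>transport x\<close> and then multiplying by \<open>transport y s\<close> on the right
  recovers \<open>e\<close>.\<close>

lemma perm_inject:
  assumes "e \<in> E x y" "f \<in> E x y" "x \<noteq> w" "y \<noteq> w" "perm x y e = perm x y f"
  shows "e = f"
proof -
  obtain s where s: "s \<in> E u w" using E_nonempty root by blast
  have ks: "transport y s \<in> E y w" using transport_from(1) s E_D[OF assms(1)] assms by simp
  have "transport x (e \<star> transport y s) = transport x (f \<star> transport y s)"
    using fun_cong[OF assms(5), of s] s by (simp add: perm_def)
  then have "e \<star> transport y s = f \<star> transport y s"
    using transport_to(2)[OF third_edge(1)[OF assms(1) ks \<open>x \<noteq> w\<close>]]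
      transport_to(2)[OF third_edge(1)[OF assms(2) ks \<open>x \<noteq> w\<close>]] by metis
  then show ?thesis
    using third_edge_right_cancel[OF assms(1) ks] third_edge_right_cancel[OF assms(2) ks] assms(3)
    by metis
qed

lemma perm_extensional: "perm x y e \<in> extensional (E u w)"
  by (simp add: perm_def)

text \<open>Composing with a base edge, whose permutation is the identity, moves the target without
  any other effect. Together with \<open>perm_change_source\<close> this lets a permutation be
  realized on other pairs of vertices.\<close>

lemma perm_change_target:
  assumes "e \<in> E x y" "x \<noteq> w" "y \<noteq> w" "z \<in> V" "z \<noteq> w" "z \<noteq> x" "z \<noteq> y"
  shows "perm x z (e \<star> base_edge y z) = perm x y e"
proof -
  have "perm x z (e \<star> base_edge y z) = compose (E u w) (perm x y e) (\<lambda>s\<in>E u w. s)"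
    using perm_mult[OF assms(1) base_edge_in, of z] perm_base_edge[of y z] assms E_D[OF assms(1)]
    by simp
  also have "\<dots> = perm x y e"
    using perm_extensional[of x y e] by (auto simp: compose_def restrict_def extensional_def)
  finally show ?thesis .
qed

lemma perm_change_source:
  assumes "e \<in> E x y" "x \<noteq> w" "y \<noteq> w" "z \<in> V" "z \<noteq> w" "z \<noteq> x" "z \<noteq> y"
  shows "perm z y (base_edge z x \<star> e) = perm x y e"
proof -
  have "perm z y (base_edge z x \<star> e) = compose (E u w) (\<lambda>s\<in>E u w. s) (perm x y e)"
    using perm_mult[OF base_edge_in assms(1), of z] perm_base_edge[of z x] assms E_D[OF assms(1)]
    by simp
  also have "\<dots> = perm x y e"
    using perm_extensional[of x y e] perm_maps[OF assms(1-3)]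
    by (fastforce simp: compose_def restrict_def extensional_def)
  finally show ?thesis .
qed

section \<open>The group and its order\<close>

definition perms :: "('e \<Rightarrow> 'e) set" where
  "perms = {perm x y e | x y e. x \<noteq> w \<and> y \<noteq> w \<and> e \<in> E x y}"

text \<open>The ends of an edge can be moved one at a time without changing its permutation, so
  every pair of distinct vertices other than \<open>w\<close> yields the same set.\<close>

lemma perms_eq:
  assumes "x \<in> V" "y \<in> V" "x \<noteq> w" "y \<noteq> w" "x \<noteq> y"
  shows "perms = perm x y ` E x y"
proof -
  have tgt: "perm p q ` E p q \<subseteq> perm p r ` E p r"
    if "p \<noteq> w" "q \<noteq> w" "r \<in> V" "r \<noteq> w" "r \<noteq> p" for p q r
  proof (cases "r = q")
    case False
    show ?thesis
    proof clarify
      fix e assume e: "e \<in> E p q"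
      then have "e \<star> base_edge q r \<in> E p r"
        using third_edge(1)[OF e base_edge_in, of r] that False E_D[OF e] by auto
      then show "perm p q e \<in> perm p r ` E p r"
        using perm_change_target[OF e] that False by (metis image_eqI)
    qed
  qed auto
  have src: "perm p q ` E p q \<subseteq> perm r q ` E r q"
    if "p \<noteq> w" "q \<noteq> w" "r \<in> V" "r \<noteq> w" "r \<noteq> q" for p q r
  proof (cases "r = p")
    case False
    show ?thesis
    proof clarify
      fix e assume e: "e \<in> E p q"
      then have "base_edge r p \<star> e \<in> E r q"
        using third_edge(1)[OF base_edge_in e, of r] that False E_D[OF e] by auto
      then show "perm p q e \<in> perm r q ` E r q"
        using perm_change_source[OF e] that False by (metis image_eqI)
    qed
  qed auto
  have "perm p q ` E p q \<subseteq> perm x y ` E x y" if "p \<noteq> w" "q \<noteq> w" "p \<in> V" "q \<in> V" "p \<noteq> q" for p q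
  proof -
    \<comment> \<open>Moving \<open>q\<close> directly to \<open>y\<close> would fail for
      \<open>y = p\<close>. The intermediate target \<open>z\<close> avoids both \<open>p\<close>
      and \<open>x\<close>, so each of the three moves stays between distinct vertices.\<close>
    obtain z where z: "z \<in> V" "z \<noteq> w" "z \<noteq> x" "z \<noteq> p" using fourth_vertex by metis
    have "perm p q ` E p q \<subseteq> perm p z ` E p z" using tgt that z by blast
    also have "\<dots> \<subseteq> perm x z ` E x z" using src that z assms by blast
    also have "\<dots> \<subseteq> perm x y ` E x y" using tgt z assms by blast
    finally show ?thesis .
  qed
  then have "perm p q e \<in> perm x y ` E x y" if "p \<noteq> w" "q \<noteq> w" "e \<in> E p q" for p q e
    using E_D[OF that(3)] that by blast
  then show ?thesis
    using assms by (auto simp: perms_def)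
qed

definition perm_group :: "('e \<Rightarrow> 'e) monoid" where
  "perm_group = \<lparr>carrier = perms, mult = compose (E u w), one = (\<lambda>s\<in>E u w. s)\<rparr>"

lemma perm_group_simps [simp]:
  "carrier perm_group = perms" "f \<otimes>\<^bsub>perm_group\<^esub> g = compose (E u w) f g"
  "\<one>\<^bsub>perm_group\<^esub> = (\<lambda>s\<in>E u w. s)"
  by (simp_all add: perm_group_def)

lemma perm_in: "e \<in> E x y \<Longrightarrow> x \<noteq> w \<Longrightarrow> y \<noteq> w \<Longrightarrow> perm x y e \<in> perms"
  by (auto simp: perms_def)

lemma perms_maps: "f \<in> perms \<Longrightarrow> f \<in> E u w \<rightarrow> E u w"
  using perm_maps by (auto simp: perms_def)

lemma group_perm_group: "group perm_group"
proof (rule groupI)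
  fix f g assume f: "f \<in> carrier perm_group" and g: "g \<in> carrier perm_group"
  obtain x y e where e: "x \<noteq> w" "y \<noteq> w" "e \<in> E x y" "f = perm x y e"
    using f by (auto simp: perms_def)
  obtain z where z: "z \<in> V" "z \<noteq> w" "z \<noteq> x" "z \<noteq> y" using fourth_vertex by metis
  \<comment> \<open>By \<open>perms_eq\<close> the second factor is also induced by an edge leaving
    \<open>y\<close>, which makes it composable with \<open>e\<close>; \<open>z \<noteq> x\<close>
    keeps \<open>perm_mult\<close> applicable.\<close>
  obtain e' where e': "e' \<in> E y z" "g = perm y z e'"
    using g perms_eq[of y z] z e E_D[OF e(3)] by auto
  show "f \<otimes>\<^bsub>perm_group\<^esub> g \<in> carrier perm_group"
    using perm_mult[OF e(3) e'(1)] z e e' perm_in third_edge(1)[OF e(3) e'(1)] by simp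
next
  obtain x where "x \<in> V" "x \<noteq> w" "x \<noteq> u" using fourth_vertex by metis
  then show "\<one>\<^bsub>perm_group\<^esub> \<in> carrier perm_group"
    using perm_base_edge[of u x] perm_in[OF base_edge_in, of u x] root by simp
next
  fix f g h
  assume "f \<in> carrier perm_group" "g \<in> carrier perm_group" "h \<in> carrier perm_group"
  then show "f \<otimes>\<^bsub>perm_group\<^esub> g \<otimes>\<^bsub>perm_group\<^esub> h = f \<otimes>\<^bsub>perm_group\<^esub> (g \<otimes>\<^bsub>perm_group\<^esub> h)"
    using compose_assoc[of h "E u w" "E u w" f g] perms_maps by simp
next
  fix f assume f: "f \<in> carrier perm_group"
  then have "f \<in> extensional (E u w)" using perm_extensional by (auto simp: perms_def)
  then show "\<one>\<^bsub>perm_group\<^esub> \<otimes>\<^bsub>perm_group\<^esub> f = f"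
    using f perms_maps[of f] by (fastforce simp: compose_def restrict_def extensional_def)
  show "\<exists>g\<in>carrier perm_group. g \<otimes>\<^bsub>perm_group\<^esub> f = \<one>\<^bsub>perm_group\<^esub>"
  proof -
    obtain x y e where e: "x \<noteq> w" "y \<noteq> w" "e \<in> E x y" "f = perm x y e"
      using f by (auto simp: perms_def)
    then have "e \<in> E y x" by (simp add: edges_between_commute)
    then show ?thesis
      using perm_inverse[of e y x] perm_in[of e y x] e by auto
  qed
qed

lemma order_perm_group: "order perm_group = t"
proof -
  obtain x where x: "x \<in> V" "x \<noteq> w" "x \<noteq> u" using fourth_vertex by metis
  have "inj_on (perm u x) (E u x)"
    using perm_inject x root by (auto simp: inj_on_def)
  then show ?thesis
    using perms_eq[of u x] x root card_edges_between[of u x] by (simp add: order_def card_image)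
qed

lemma inv_perm:
  assumes "e \<in> E x y" "x \<noteq> w" "y \<noteq> w"
  shows "inv\<^bsub>perm_group\<^esub> (perm x y e) = perm y x e"
proof -
  have "e \<in> E y x" using assms(1) by (simp add: edges_between_commute)
  then show ?thesis
    using perm_inverse[of e y x] assms perm_in
    by (intro group.inv_equality[OF group_perm_group]) auto
qed

subsection \<open>Gains\<close>

text \<open>\<open>perm\<close> only handles edges that avoid \<open>w\<close>. An edge at
  \<open>w\<close> is first pushed off the root by a base edge to an auxiliary vertex, whose choice
  does not matter by \<open>gain_from_root\<close>.\<close>

definition gain :: "'v \<Rightarrow> 'v \<Rightarrow> 'e \<Rightarrow> 'e \<Rightarrow> 'e" where
  "gain x y e =
     (let p = \<lambda>x. SOME p. p \<in> V \<and> p \<noteq> w \<and> p \<noteq> x in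
      if x = w then perm (p y) y (base_edge (p y) w \<star> e)
      else if y = w then perm x (p x) (e \<star> base_edge w (p x))
      else perm x y e)"

text \<open>Passing from \<open>p\<close> to \<open>q\<close> multiplies the edge on the left by
  \<open>base_edge q p\<close>, by associativity along \<open>q\<close>, \<open>p\<close>,
  \<open>w\<close>, \<open>y\<close>, and this does not affect the permutation.\<close>

lemma gain_from_root:
  assumes e: "e \<in> E w y" and q: "q \<in> V" "q \<noteq> w" "q \<noteq> y"
  shows "gain w y e = perm q y (base_edge q w \<star> e)"
proof -
  define p where "p = (SOME p. p \<in> V \<and> p \<noteq> w \<and> p \<noteq> y)"
  have p: "p \<in> V" "p \<noteq> w" "p \<noteq> y"
    using someI_ex[of "\<lambda>p. p \<in> V \<and> p \<noteq> w \<and> p \<noteq> y"] fourth_vertex[of w y y] unfolding p_def by auto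
  have yw: "y \<noteq> w" using E_D[OF e] by auto
  have F: "base_edge p w \<in> E p w" using base_edge_in[of p w] root p by simp
  have pe: "base_edge p w \<star> e \<in> E p y" using third_edge(1)[OF F e] p by simp
  have g: "gain w y e = perm p y (base_edge p w \<star> e)" by (simp add: gain_def p_def)
  show ?thesis
  proof (cases "q = p")
    case False
    have "perm p y (base_edge p w \<star> e) = perm q y (base_edge q p \<star> (base_edge p w \<star> e))"
      using perm_change_source[OF pe p(2) yw q(1,2) False q(3)] by simp
    also have "base_edge q p \<star> (base_edge p w \<star> e) = (base_edge q p \<star> base_edge p w) \<star> e"
      using third_edge_assoc[OF base_edge_in F e, of q] p q False by simp
    also have "base_edge q p \<star> base_edge p w = base_edge q w"
      using base_edge_mult p q False root by simp
    finally show ?thesis using g by simp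
  qed (simp add: g)
qed

text \<open>Both gains use the same auxiliary vertex and, by commutativity, the same edge, read in
  opposite directions.\<close>

lemma gain_to_root:
  assumes "e \<in> E w y"
  shows "gain y w e = inv\<^bsub>perm_group\<^esub> (gain w y e)"
proof -
  define p where "p = (SOME p. p \<in> V \<and> p \<noteq> w \<and> p \<noteq> y)"
  have p: "p \<in> V" "p \<noteq> w" "p \<noteq> y"
    using someI_ex[of "\<lambda>p. p \<in> V \<and> p \<noteq> w \<and> p \<noteq> y"] fourth_vertex[of w y y] unfolding p_def by auto
  have "base_edge p w \<in> E p w" using base_edge_in[of p w] root p by simp
  then have pe: "base_edge p w \<star> e \<in> E p y" using third_edge(1)[OF _ assms] p by simp
  have yw: "y \<noteq> w" using E_D[OF assms] by auto
  then have "gain y w e = perm y p (e \<star> base_edge w p)"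
    by (simp add: gain_def p_def)
  also have "e \<star> base_edge w p = base_edge p w \<star> e"
    by (metis third_edge_commute base_edge_commute)
  also have "perm y p (base_edge p w \<star> e) = inv\<^bsub>perm_group\<^esub> (perm p y (base_edge p w \<star> e))"
    using inv_perm[OF pe p(2) yw] by simp
  finally show ?thesis by (simp add: gain_def p_def)
qed

lemma gain_perm: "x \<noteq> w \<Longrightarrow> y \<noteq> w \<Longrightarrow> gain x y e = perm x y e"
  by (simp add: gain_def)

lemma gain_root_in:
  assumes "e \<in> E w y" shows "gain w y e \<in> perms"
proof -
  obtain q where q: "q \<in> V" "q \<noteq> w" "q \<noteq> y" using fourth_vertex by metis
  show ?thesis
    using gain_from_root[OF assms q] perm_in third_edge(1)[OF base_edge_in assms, of q] q E_D[OF assms]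
    by auto
qed

lemma gain_in:
  assumes "e \<in> E x y" shows "gain x y e \<in> perms"
proof -
  interpret group perm_group by (rule group_perm_group)
  show ?thesis
    using assms gain_root_in gain_to_root gain_perm perm_in inv_closed E_D[OF assms]
    by (metis edges_between_commute perm_group_simps(1))
qed

lemma gain_inverse:
  assumes "e \<in> E x y" shows "gain y x e = inv\<^bsub>perm_group\<^esub> (gain x y e)"
proof -
  interpret group perm_group by (rule group_perm_group)
  have "e \<in> E y x" using assms by (simp add: edges_between_commute)
  then show ?thesis
    using assms gain_to_root[of e] gain_perm inv_perm[OF assms] E_D[OF assms] gain_root_in[of e]
    by (cases "x = w"; cases "y = w") auto
qed

lemma gain_inject:
  assumes "e \<in> E x y" "f \<in> E x y" "gain x y e = gain x y f" shows "e = f"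
proof -
  interpret group perm_group by (rule group_perm_group)
  have root: "a = b" if a: "a \<in> E w z" and b: "b \<in> E w z" and eq: "gain w z a = gain w z b" for a b z
  proof -
    obtain q where q: "q \<in> V" "q \<noteq> w" "q \<noteq> z" using fourth_vertex by metis
    have F: "base_edge q w \<in> E q w" using base_edge_in[of q w] root q by simp
    have "base_edge q w \<star> a = base_edge q w \<star> b"
      using perm_inject[OF third_edge(1)[OF F a] third_edge(1)[OF F b]] eq q E_D[OF a]
        gain_from_root[OF a q] gain_from_root[OF b q] by auto
    then show "a = b"
      using third_edge_left_cancel[OF F a] third_edge_left_cancel[OF F b] q by metis
  qed
  have yx: "e \<in> E y x" "f \<in> E y x" using assms by (simp_all add: edges_between_commute)
  consider "x = w" | "y = w" | "x \<noteq> w" "y \<noteq> w" by blast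
  then show ?thesis
  proof cases
    case 1
    then show ?thesis using root assms by blast
  next
    case 2
    have "gain y x e = gain y x f"
      using gain_inverse[OF assms(1)] gain_inverse[OF assms(2)] assms(3) by simp
    then show ?thesis using root yx 2 by blast
  next
    case 3
    then show ?thesis using perm_inject assms gain_perm by simp
  qed
qed

text \<open>One auxiliary vertex \<open>q\<close> off \<open>w\<close>, \<open>y\<close>,
  \<open>z\<close> serves both \<open>a\<close> and \<open>a \<star> b\<close>. Associativity along
  \<open>q\<close>, \<open>w\<close>, \<open>y\<close>, \<open>z\<close> then turns the claim into
  \<open>perm_mult\<close> away from the root.\<close>

lemma gain_mult_from_root:
  assumes a: "a \<in> E w y" and b: "b \<in> E y z" and "w \<noteq> z"
  shows "gain w z (a \<star> b) = gain w y a \<otimes>\<^bsub>perm_group\<^esub> gain y z b"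
proof -
  obtain q where q: "q \<in> V" "q \<noteq> w" "q \<noteq> y" "q \<noteq> z" using fourth_vertex by metis
  have F: "base_edge q w \<in> E q w" using base_edge_in[of q w] root q by simp
  have Fa: "base_edge q w \<star> a \<in> E q y" using third_edge(1)[OF F a] q by simp
  have yw: "y \<noteq> w" using E_D[OF a] by auto
  note ab = third_edge(1)[OF a b \<open>w \<noteq> z\<close>]
  have "gain w z (a \<star> b) = perm q z (base_edge q w \<star> (a \<star> b))"
    using gain_from_root[OF ab] q by simp
  also have "base_edge q w \<star> (a \<star> b) = (base_edge q w \<star> a) \<star> b"
    using third_edge_assoc[OF F a b] q assms(3) by simp
  also have "perm q z \<dots> = compose (E u w) (perm q y (base_edge q w \<star> a)) (perm y z b)"
    using perm_mult[OF Fa b q(4,2) yw] assms(3) by simp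
  finally show ?thesis
    using gain_from_root[OF a q(1-3)] gain_perm[OF yw, of z b] assms(3) by simp
qed

text \<open>The other positions of the root reduce to \<open>gain_mult_from_root\<close>: for
  \<open>y = w\<close> it is applied to \<open>a \<star> (a \<star> b) = b\<close> and solved for
  the gain of the product; for \<open>z = w\<close> the path is reversed and inverses are
  taken.\<close>

lemma gain_mult:
  assumes a: "a \<in> E x y" and b: "b \<in> E y z" and "x \<noteq> z"
  shows "gain x z (a \<star> b) = gain x y a \<otimes>\<^bsub>perm_group\<^esub> gain y z b"
proof -
  interpret group perm_group by (rule group_perm_group)
  note ab = third_edge(1)[OF assms]
  have a': "a \<in> E y x" using a by (simp add: edges_between_commute)
  have b': "b \<in> E z y" using b by (simp add: edges_between_commute)
  have c: "gain x y a \<in> carrier perm_group" "gain y z b \<in> carrier perm_group"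
    "gain x z (a \<star> b) \<in> carrier perm_group"
    using gain_in[OF a] gain_in[OF b] gain_in[OF ab] by simp_all
  consider "x = w" | "y = w" | "z = w" | "x \<noteq> w" "y \<noteq> w" "z \<noteq> w" by blast
  then show ?thesis
  proof cases
    case 1
    then show ?thesis using gain_mult_from_root assms by blast
  next
    case 2
    have "y \<noteq> z" using E_D[OF b] by auto
    then have "gain y z (a \<star> (a \<star> b)) = gain y x a \<otimes>\<^bsub>perm_group\<^esub> gain x z (a \<star> b)"
      using gain_mult_from_root[OF a'[unfolded 2] ab] unfolding 2 by blast
    then have "gain y z b = inv\<^bsub>perm_group\<^esub> (gain x y a) \<otimes>\<^bsub>perm_group\<^esub> gain x z (a \<star> b)"
      unfolding third_edge_left_cancel[OF assms] gain_inverse[OF a] .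
    then show ?thesis using inv_solve_left[OF c(2,1,3)] by blast
  next
    case 3
    have "z \<noteq> x" using assms(3) by blast
    then have "gain z x (b \<star> a) = gain z y b \<otimes>\<^bsub>perm_group\<^esub> gain y x a"
      using gain_mult_from_root[OF b'[unfolded 3] a'] unfolding 3 by blast
    then have "inv\<^bsub>perm_group\<^esub> (gain x z (a \<star> b)) =
        inv\<^bsub>perm_group\<^esub> (gain y z b) \<otimes>\<^bsub>perm_group\<^esub> inv\<^bsub>perm_group\<^esub> (gain x y a)"
      unfolding third_edge_commute[of b a] gain_inverse[OF a] gain_inverse[OF b] gain_inverse[OF ab] .
    then show ?thesis using inv_mult_group[OF c(1,2)] inv_inv c by (metis m_closed)
  next
    case 4
    then show ?thesis using perm_mult[OF assms] gain_perm by simp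
  qed
qed

end

subsection \<open>Closed walks\<close>

text \<open>\<open>perm_group\<close> consists of functions on edges, while the theorem provides a
  group on \<open>nat\<close>; an injection of the finite carrier into \<open>nat\<close> carries
  the structure over.\<close>

lemma nat_group_iso:
  assumes "group H" "finite (carrier H)"
  shows "\<exists>(K :: nat monoid) h. group K \<and> h \<in> iso H K"
proof -
  obtain h :: "'a \<Rightarrow> nat" where h: "inj_on h (carrier H)"
    using finite_imp_inj_to_nat_seg assms(2) by blast
  interpret group H by fact
  have "h \<in> iso H (image_group h H)"
    using h by (auto intro!: isoI homI simp: image_group_def bij_betw_def)
  moreover from iso_imp_img_group[OF this] have "group (image_group h H)"
    by (simp add: image_group_def)
  ultimately show ?thesis by blast
qed

text \<open>The first edge leads to a vertex other than \<open>y\<close>, and all later edges avoid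
  \<open>x\<close>. In the shortening step below this ensures that the new chord is not already an
  edge of the remaining walk.\<close>

lemma (in triangular_biased_graph) no_parallel_edge_in_path:
  assumes "is_path G x p y" "length p \<ge> 2" "e \<in> E x y"
  shows "e \<notin> walk_edges p"
proof -
  obtain f z q where p: "p = (f, z) # q" "q \<noteq> []"
    using assms(2) by (cases p) (auto simp: Suc_le_eq)
  have w: "is_walk G z q y" and f: "ends G f = {x, z}" and d: "x \<notin> insert z (set (map snd q))"
    "z \<notin> set (map snd q)"
    using assms(1) by (auto simp: p is_path_def)
  have "z \<noteq> y" using walk_end_mem[OF w p(2)] d by auto
  moreover have "e \<notin> walk_edges q"
    using ends_subset_walk_verts[OF w, of e] d E_D[OF assms(3)] by auto
  ultimately show ?thesis
    using f E_D[OF assms(3)] by (auto simp: p doubleton_eq_iff)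
qed

text \<open>A long closed walk is shortened by replacing its first two edges with the edge completing
  them to a balanced triangle: this preserves both the label and, by the theta property,
  membership in \<open>B\<close>.\<close>

lemma (in triangular_biased_graph) closed_walk_balanced_iff:
  fixes \<Gamma> :: "'g monoid" and L :: "('v, 'e, 'g) labeling"
  assumes \<Gamma>: "group \<Gamma>"
    and step: "\<And>e x y. e \<in> E x y \<Longrightarrow>
      (if src L e = x then label L e else inv\<^bsub>\<Gamma>\<^esub> (label L e)) = g x y e"
    and g_in: "\<And>e x y. e \<in> E x y \<Longrightarrow> g x y e \<in> carrier \<Gamma>"
    and g_inverse: "\<And>e x y. e \<in> E x y \<Longrightarrow> g y x e = inv\<^bsub>\<Gamma>\<^esub> (g x y e)"
    and g_inject: "\<And>e f x y. e \<in> E x y \<Longrightarrow> f \<in> E x y \<Longrightarrow> g x y e = g x y f \<Longrightarrow> e = f"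
    and g_mult: "\<And>a b x y z. a \<in> E x y \<Longrightarrow> b \<in> E y z \<Longrightarrow> x \<noteq> z \<Longrightarrow>
      g x z (a \<star> b) = g x y a \<otimes>\<^bsub>\<Gamma>\<^esub> g y z b"
  shows "simple_closed_walk G v p \<Longrightarrow> walk_edges p \<in> B \<longleftrightarrow> walk_label \<Gamma> L v p = \<one>\<^bsub>\<Gamma>\<^esub>"
proof (induction p rule: length_induct)
  case (1 p)
  interpret group \<Gamma> by fact
  have label_step: "walk_label \<Gamma> L x ((e, y) # q) = g x y e \<otimes>\<^bsub>\<Gamma>\<^esub> walk_label \<Gamma> L y q"
    if "e \<in> E x y" for e x y q
    using step[OF that] by simp
  have walk_step: "is_walk G x ((e, y) # q) z \<longleftrightarrow> e \<in> E x y \<and> is_walk G y q z" for e x y q z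
    using E_D[of e x y] by (auto simp: edges_between_def)
  have mult_inv_eq_one: "c \<otimes>\<^bsub>\<Gamma>\<^esub> inv\<^bsub>\<Gamma>\<^esub> d = \<one>\<^bsub>\<Gamma>\<^esub> \<longleftrightarrow> c = d"
    if "c \<in> carrier \<Gamma>" "d \<in> carrier \<Gamma>" for c d
    using that by (metis inv_closed inv_equality inv_inv r_inv)
  have label_in: "walk_label \<Gamma> L x q \<in> carrier \<Gamma>" if "is_walk G x q z" for x q z
    using that
  proof (induction q arbitrary: x)
    case (Cons a q)
    then show ?case
      using label_step walk_step g_in by (cases a) (metis m_closed)
  qed simp
  have no_B: "walk_edges p \<notin> B" if "length p \<le> 2"
  proof
    assume "walk_edges p \<in> B"
    then have "3 \<le> card (walk_edges p)" by (rule card_balanced)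
    also have "\<dots> \<le> length p" unfolding walk_edges_def by (metis card_length length_map)
    finally show False using that by simp
  qed
  note scw = 1(2)[unfolded simple_closed_walk_def]
  \<comment> \<open>Length one would need a loop. Two edges give neither a member of
    \<open>B\<close> nor a trivial label, since parallel edges have distinct values of
    \<open>g\<close>. Length three reduces to uniqueness of the third edge; from length four on the
    walk is shortened.\<close>
  consider "p = []" | a where "p = [a]" | a b where "p = [a, b]" | a b c where "p = [a, b, c]"
    | a b c d r where "p = a # b # c # d # r"
    by (metis neq_Nil_conv)
  then show ?case
  proof cases
    case 1
    then show ?thesis using scw by simp
  next
    case (2 a)
    then show ?thesis using scw walk_step E_D by (cases a) (metis is_walk.simps(1))
  next
    case (3 a b)
    obtain e x f y where ab: "a = (e, x)" "b = (f, y)" by (cases a; cases b)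
    have y: "y = v" and e: "e \<in> E v x" and f: "f \<in> E x v" and ef: "e \<noteq> f"
      using scw walk_step by (auto simp: 3 ab simp del: is_walk.simps(2))
    have f': "f \<in> E v x" using f by (simp add: edges_between_commute)
    have "walk_label \<Gamma> L v p = g v x e \<otimes>\<^bsub>\<Gamma>\<^esub> inv\<^bsub>\<Gamma>\<^esub> (g v x f)"
      using label_step[OF e] label_step[OF f] g_in[OF f] g_inverse[OF f']
      by (simp add: 3 ab y del: walk_label.simps(2))
    moreover have "g v x e \<noteq> g v x f" using g_inject[OF e f'] ef by blast
    ultimately show ?thesis
      using no_B mult_inv_eq_one[OF g_in[OF e] g_in[OF f']] 3 by simp
  next
    case (4 a b c)
    obtain e x f y h z where abc: "a = (e, x)" "b = (f, y)" "c = (h, z)" by (cases a; cases b; cases c)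
    have z: "z = v" and e: "e \<in> E v x" and f: "f \<in> E x y" and h: "h \<in> E y v" and vy: "v \<noteq> y"
      using scw walk_step by (auto simp: 4 abc simp del: is_walk.simps(2))
    have h': "h \<in> E v y" using h by (simp add: edges_between_commute)
    note ef = third_edge[OF e f vy]
    have "walk_label \<Gamma> L v p = g v y (e \<star> f) \<otimes>\<^bsub>\<Gamma>\<^esub> inv\<^bsub>\<Gamma>\<^esub> (g v y h)"
      using label_step[OF e] label_step[OF f] label_step[OF h] g_in[OF h] g_in[OF f] g_in[OF e]
        g_inverse[OF h'] g_mult[OF e f vy] by (simp add: 4 abc z m_assoc del: walk_label.simps(2))
    then have "walk_label \<Gamma> L v p = \<one>\<^bsub>\<Gamma>\<^esub> \<longleftrightarrow> g v y (e \<star> f) = g v y h"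
      using mult_inv_eq_one[OF g_in[OF ef(1)] g_in[OF h']] by simp
    also have "\<dots> \<longleftrightarrow> e \<star> f = h" using g_inject[OF ef(1) h'] by blast
    also have "\<dots> \<longleftrightarrow> walk_edges p \<in> B"
      using ef(2) third_edge_eqI[OF e f vy h'] by (auto simp: 4 abc)
    finally show ?thesis by simp
  next
    case (5 a b c d r)
    obtain e x f y where ab: "a = (e, x)" "b = (f, y)" by (cases a; cases b)
    define q where "q = c # d # r"
    have p: "p = (e, x) # (f, y) # q" by (simp add: 5 ab q_def)
    have e: "e \<in> E v x" and f: "f \<in> E x y" and q: "is_walk G y q v"
      using scw walk_step by (auto simp: p simp del: is_walk.simps(2))
    have v: "v \<in> set (map snd q)" using walk_end_mem[OF q] by (simp add: q_def)
    have d: "distinct (x # y # map snd q)" "distinct (e # f # map fst q)"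
      using scw by (simp_all add: p)
    have xyv: "x \<noteq> y" "x \<noteq> v" "y \<noteq> v" using d v by auto
    have vy: "v \<noteq> y" using xyv by simp
    have path: "is_path G y q v" using q d by (simp add: is_path_def)
    note ef = third_edge[OF e f vy]
    have ef': "e \<star> f \<in> E y v" using ef(1) by (simp add: edges_between_commute)
    have notin: "e \<star> f \<notin> walk_edges q"
      using no_parallel_edge_in_path[OF path _ ef'] by (simp add: q_def)
    note D = E_D[OF e] E_D[OF f] E_D[OF ef']
    have ne: "e \<star> f \<noteq> e" "e \<star> f \<noteq> f" using D xyv by (auto simp: doubleton_eq_iff)
    have nq: "e \<notin> walk_edges q" "f \<notin> walk_edges q" using d(2) by (auto simp: walk_edges_def)
    have xq: "x \<notin> internal_verts q"
      using d(1) unfolding internal_verts_def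
      by (metis distinct.simps(2) in_set_butlastD list.set_intros(2))
    \<comment> \<open>The theta has ends \<open>y\<close> and \<open>v\<close>: the chord, the first
      two edges traversed backwards, and the rest of the walk.\<close>
    let ?P = "[(e \<star> f, v)]" and ?Q = "[(f, x), (e, v)]"
    have paths: "is_path G y ?P v" "is_path G y ?Q v"
      using D xyv by (auto simp: is_path_def insert_commute)
    have ints: "internally_disjoint ?P ?Q" "internally_disjoint ?P q" "internally_disjoint ?Q q"
      "internally_disjoint ?Q ?P"
      using xq by (auto simp: internally_disjoint_def internal_verts_def)
    have disj: "walk_edges ?P \<inter> walk_edges ?Q = {}" "walk_edges ?P \<inter> walk_edges q = {}"
      "walk_edges ?Q \<inter> walk_edges q = {}" "walk_edges ?Q \<inter> walk_edges ?P = {}"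
      using notin nq ne by auto
    have tri: "walk_edges ?P \<union> walk_edges ?Q \<in> B" "walk_edges ?Q \<union> walk_edges ?P \<in> B"
      using ef(2) by (simp_all add: insert_commute)
    have "walk_edges p \<in> B \<longleftrightarrow> walk_edges ?Q \<union> walk_edges q \<in> B"
      by (simp add: p insert_commute)
    \<comment> \<open>The two directions are two transfers in the same theta, with the roles of
      chord and detour exchanged.\<close>
    also have "\<dots> \<longleftrightarrow> walk_edges ?P \<union> walk_edges q \<in> B"
      using theta_transfer[OF biased loopless xyv(3) paths path ints(1-3) disj(1-3) tri(1)]
        theta_transfer[OF biased loopless xyv(3) paths(2,1) path ints(4,3,2) disj(4,3,2) tri(2)]
      by blast
    also have "\<dots> \<longleftrightarrow> walk_edges ((e \<star> f, y) # q) \<in> B" by simp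
    also have "\<dots> \<longleftrightarrow> walk_label \<Gamma> L v ((e \<star> f, y) # q) = \<one>\<^bsub>\<Gamma>\<^esub>"
    proof -
      have "simple_closed_walk G v ((e \<star> f, y) # q)"
        using d ef(1) q notin walk_step
        by (auto simp: simple_closed_walk_def walk_edges_def simp del: is_walk.simps(2))
      then show ?thesis using 1(1) by (metis p length_Cons lessI)
    qed
    also have "walk_label \<Gamma> L v ((e \<star> f, y) # q) = walk_label \<Gamma> L v p"
      using label_step[OF ef(1)] label_step[OF e] label_step[OF f] g_mult[OF e f vy]
        g_in[OF e] g_in[OF f] label_in[OF q] by (simp add: p m_assoc del: walk_label.simps(2))
    finally show ?thesis .
  qed
qed

theorem theorem4p5:
  fixes t m :: nat
    and G :: "('v, 'e) multigraph"
    and B :: "'e set set"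
  assumes "t \<ge> 1" and "m \<ge> 4"
    and "biased_graph G B"
    and "loopless G"
    and "card (verts G) = m"
    and "\<And>x y. x \<in> verts G \<Longrightarrow> y \<in> verts G \<Longrightarrow> x \<noteq> y \<Longrightarrow> card (edges_between G x y) = t"
    and "\<And>C. C \<in> B \<Longrightarrow> card C \<ge> 3"
    and "\<And>b1 b2 b3 a b. b1 \<in> verts G \<Longrightarrow> b2 \<in> verts G \<Longrightarrow> b3 \<in> verts G \<Longrightarrow>
           b1 \<noteq> b2 \<Longrightarrow> b1 \<noteq> b3 \<Longrightarrow> b2 \<noteq> b3 \<Longrightarrow>
           a \<in> edges_between G b1 b2 \<Longrightarrow> b \<in> edges_between G b1 b3 \<Longrightarrow>
           \<exists>c\<in>edges_between G b2 b3. {a, b, c} \<in> B"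
  shows "\<exists>(\<Gamma> :: nat monoid) (L :: ('v, 'e, nat) labeling).
           group \<Gamma> \<and> order \<Gamma> = t \<and> group_labeling G \<Gamma> L \<and>
           (\<forall>x\<in>verts G. \<forall>y\<in>verts G. x \<noteq> y \<longrightarrow>
              (\<forall>e\<in>edges_between G x y. \<forall>f\<in>edges_between G x y.
                 src L e = src L f \<and> tgt L e = tgt L f) \<and>
              inj_on (label L) (edges_between G x y)) \<and>
           B = balanced_cycles G \<Gamma> L"
proof -
  interpret triangular_biased_graph G B t
    by (rule triangular_biased_graph.intro[OF assms(3,4) _ assms(1,6,7,8)])
      (use assms(2,5) in simp_all)
  obtain w where w: "w \<in> V" using fourth_vertex by metis
  obtain u where u: "u \<in> V" "u \<noteq> w" using fourth_vertex by metis
  interpret rooted_triangular_biased_graph G B t w u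
    by unfold_locales (fact w u)+
  \<comment> \<open>\<open>order\<close> is 0 for an infinite carrier, so \<open>t \<ge> 1\<close>
    yields finiteness.\<close>
  have "finite (carrier perm_group)"
    using order_perm_group t_pos by (metis card.infinite not_one_le_zero order_def)
  then obtain \<Gamma> :: "nat monoid" and h where \<Gamma>: "group \<Gamma>" and h: "h \<in> iso perm_group \<Gamma>"
    using nat_group_iso[OF group_perm_group] by blast
  interpret H: group_hom perm_group \<Gamma> h
    using h \<Gamma> group_perm_group by (auto simp: group_hom_def group_hom_axioms_def iso_def)
  have inj: "inj_on h perms" using h by (auto simp: iso_def bij_betw_def)
  define g where "g x y e = h (gain x y e)" for x y e
  \<comment> \<open>\<open>s e\<close> and \<open>d e\<close> depend on \<open>e\<close> only
    through \<open>ends G e\<close>, so parallel edges receive the same orientation.\<close>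
  define s where "s e = (SOME x. x \<in> ends G e)" for e
  define d where "d e = (SOME y. ends G e = {s e, y})" for e
  define L :: "('v, 'e, nat) labeling" where
    "L = \<lparr>src = s, tgt = d, label = \<lambda>e. g (s e) (d e) e\<rparr>"
  have ends: "ends G e = {s e, d e}" if "ends G e = {x, y}" for e x y
  proof -
    have "s e \<in> ends G e" unfolding s_def using that by (metis insertI1 someI)
    then have "\<exists>z. ends G e = {s e, z}" using that by (auto simp: insert_commute)
    then show ?thesis unfolding d_def by (rule someI_ex)
  qed
  have E_sd: "e \<in> E (s e) (d e)" if "e \<in> E x y" for e x y
    using that ends by (auto simp: edges_between_def)
  have orient: "s e = s f \<and> d e = d f" if "e \<in> E x y" "f \<in> E x y" for e f x y
    using that by (simp add: edges_between_def s_def d_def)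
  have g_in: "g x y e \<in> carrier \<Gamma>" if "e \<in> E x y" for e x y
    using gain_in[OF that] by (simp add: g_def)
  have g_inverse: "g y x e = inv\<^bsub>\<Gamma>\<^esub> (g x y e)" if "e \<in> E x y" for e x y
    using gain_in[OF that] gain_inverse[OF that] by (simp add: g_def)
  have g_inject: "e = f" if "e \<in> E x y" "f \<in> E x y" "g x y e = g x y f" for e f x y
    using gain_inject[OF that(1,2)] gain_in that inj by (auto simp: g_def inj_on_def)
  have g_mult: "g x z (a \<star> b) = g x y a \<otimes>\<^bsub>\<Gamma>\<^esub> g y z b"
    if "a \<in> E x y" "b \<in> E y z" "x \<noteq> z" for a b x y z
    using gain_mult[OF that] gain_in that H.hom_mult by (simp add: g_def)
  have step: "(if src L e = x then label L e else inv\<^bsub>\<Gamma>\<^esub> (label L e)) = g x y e" if "e \<in> E x y" for e x y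
  proof -
    have "s e = x \<and> d e = y \<or> s e = y \<and> d e = x"
      using E_D[OF that] E_D[OF E_sd[OF that]] by (auto simp: doubleton_eq_iff)
    then show ?thesis
      using E_D[OF that] g_inverse[of e y x] that by (auto simp: L_def edges_between_commute)
  qed
  have balanced: "walk_edges p \<in> B \<longleftrightarrow> walk_label \<Gamma> L v p = \<one>\<^bsub>\<Gamma>\<^esub>"
    if "simple_closed_walk G v p" for v p
    by (rule closed_walk_balanced_iff[where g = g, OF \<Gamma> _ _ _ _ _ that])
      (fact step g_in g_inverse g_inject g_mult)+
  have "order \<Gamma> = t"
    using order_perm_group bij_betw_same_card h by (fastforce simp: iso_def order_def)
  moreover have "group_labeling G \<Gamma> L"
    unfolding group_labeling_def
  proof
    fix e assume e: "e \<in> edges G"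
    then obtain x y where "ends G e = {x, y}"
      using loopless by (auto simp: loopless_def card_2_iff)
    then show "ends G e = {src L e, tgt L e} \<and> label L e \<in> carrier \<Gamma>"
      using ends e g_in E_sd[of e x y] by (auto simp: L_def edges_between_def)
  qed
  moreover have "inj_on (label L) (E x y)" for x y
  proof (rule inj_onI)
    fix e f assume ef: "e \<in> E x y" "f \<in> E x y" and eq: "label L e = label L f"
    have sd: "s f = s e" "d f = d e" using orient[OF ef] by simp_all
    have "g (s e) (d e) e = g (s e) (d e) f" using eq by (simp add: L_def sd)
    then show "e = f" by (rule g_inject[OF E_sd[OF ef(1)] E_sd[OF ef(2), unfolded sd]])
  qed
  moreover have "B = balanced_cycles G \<Gamma> L"
  proof
    show "B \<subseteq> balanced_cycles G \<Gamma> L"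
    proof
      fix C assume C: "C \<in> B"
      then have cyc: "C \<in> cycles G" using biased by (auto simp: biased_graph_def)
      \<comment> \<open>Any closed walk around \<open>C\<close> will do, as \<open>balanced\<close>
        holds for each of them, whatever its starting vertex and direction.\<close>
      then obtain v p where p: "simple_closed_walk G v p" "C = walk_edges p"
        by (auto simp: cycles_def)
      then show "C \<in> balanced_cycles G \<Gamma> L"
        using balanced[OF p(1)] C cyc unfolding balanced_cycles_def by blast
    qed
    show "balanced_cycles G \<Gamma> L \<subseteq> B"
      using balanced unfolding balanced_cycles_def by blast
  qed
  moreover have "src L e = src L f \<and> tgt L e = tgt L f" if "e \<in> E x y" "f \<in> E x y" for e f x y
    using orient[OF that] by (simp add: L_def)
  ultimately show ?thesis using \<Gamma> by blast
qed

end
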